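(* Let $N\geqslant 2$ be an integer. Consider a geometric realization of the graph $\operatorname{Hasse}(\mathbb Y_N)$ as a metric space in which all edges have length $1$ (with the path metric), and let $X_N$ be its boundary, that is, $X_N$ is the $N$-point metric subspace consisting of the $N$ pending vertices (vertices of degree one "at the tips of the antennas"; for $N=2$ both vertices) corresponding to the rectangular partitions $(j^{N-j})$ ($N-j$ parts all equal to $j$) for $j=1,\dots,N-1$, together with the empty partition. Then the $1$-skeleton of the injective hull $\operatorname{E}(X_N)$ is a geometric realization of the graph $\operatorname{Hasse}(\mathbb Y_N)$; that is, the graph formed by the $0$-faces and $1$-faces of the polyhedral complex $\operatorname{E}(X_N)$ is isomorphic to $\operatorname{Hasse}(\mathbb Y_N)$.
   Context: $\mathbb Y_N$ is the set of integer partitions all of whose hook lengths are strictly less than $N$ (the empty partition is included). A partition $\lambda$ covers a partition $\mu$ if the Young diagram of $\mu$ is obtained from that of $\lambda$ by removing one inner corner box (a removable box). $\operatorname{Hasse}(\mathbb Y_N)$ is the undirected graph with vertex set $\mathbb Y_N$ in which $\lambda,\mu$ are joined by an edge iff one of them covers the other. A metric space $Z$ is injective if every $1$-Lipschitz map $A\to Z$ from a subspace $A$ of any metric space $Y$ extends to a $1$-Lipschitz map $Y\to Z$. An injective hull of a metric space $X$ is a smallest injective metric space containing $X$ isometrically (unique up to isometry over $X$). For a finite metric space $(X,d)$ it is realized as follows. Let $\Delta(X)=\{f\in\mathbb R^X\mid \forall x,y\in X:\ f(x)+f(y)\geqslant d(x,y)\}$ and $$\operatorname{E}(X)=\{f\in\Delta(X)\mid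 \forall x\in X\ \exists y\in X:\ f(x)+f(y)=d(x,y)\},$$ with the metric $\|f-g\|_\infty$ and the embedding $X\to\operatorname{E}(X)$, $x\mapsto d(x,\cdot)$. The set $\operatorname{E}(X)$ is the union of the bounded faces of the polyhedron $\Delta(X)$, and it is regarded as the polyhedral complex whose faces are these bounded faces. Its $1$-skeleton is the union of its faces of dimension at most $1$. *)

theory Defs
  imports "HOL-Analysis.Analysis"
begin

section \<open>Simple graphs\<close>

text \<open>A simple undirected graph is a pair (vertices, edges), each edge being a
  two-element set of vertices.\<close>

type_synonym 'a ugraph = "'a set \<times> 'a set set"

definition graph_iso :: "'a ugraph \<Rightarrow> 'b ugraph \<Rightarrow> bool" where
  "graph_iso G H \<longleftrightarrow>
     (\<exists>f. bij_betw f (fst G) (fst H) \<and> (\<lambda>e. f ` e) ` snd G = snd H)"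

text \<open>Least number of edges of a walk from \<open>u\<close> to \<open>v\<close>. In a connected graph
  this is the path metric of the geometric realization with unit edges, restricted to the
  vertices.\<close>

definition graph_dist :: "'a ugraph \<Rightarrow> 'a \<Rightarrow> 'a \<Rightarrow> nat" where
  "graph_dist G u v = (LEAST n. (u, v) \<in> {(a, b). {a, b} \<in> snd G} ^^ n)"

section \<open>Partitions with bounded hook lengths\<close>

definition is_partition :: "nat list \<Rightarrow> bool" where
  "is_partition l \<longleftrightarrow> sorted_wrt (\<ge>) l \<and> 0 \<notin> set l"

text \<open>Boxes are pairs (row, column), counted from 0.\<close>

definition young_diagram :: "nat list \<Rightarrow> (nat \<times> nat) set" where
  "young_diagram l = {(i, j). i < length l \<and> j < l ! i}"

definition hook :: "nat list \<Rightarrow> nat \<times> nat \<Rightarrow> (nat \<times> nat) set" where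
  "hook l = (\<lambda>(i, j). {(i', j') \<in> young_diagram l.
     (i' = i \<and> j \<le> j') \<or> (j' = j \<and> i \<le> i')})"

definition hook_length :: "nat list \<Rightarrow> nat \<times> nat \<Rightarrow> nat" where
  "hook_length l c = card (hook l c)"

definition hook_bounded :: "nat \<Rightarrow> nat list set" where
  "hook_bounded N = {l. is_partition l \<and> (\<forall>c\<in>young_diagram l. hook_length l c < N)}"

definition inner_corner :: "nat list \<Rightarrow> nat \<times> nat \<Rightarrow> bool" where
  "inner_corner l = (\<lambda>(i, j). (i, j) \<in> young_diagram l \<and>
     (Suc i, j) \<notin> young_diagram l \<and> (i, Suc j) \<notin> young_diagram l)"

definition covers :: "nat list \<Rightarrow> nat list \<Rightarrow> bool" where
  "covers l m \<longleftrightarrow> (\<exists>c. inner_corner l c \<and> young_diagram m = young_diagram l - {c})"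

definition hasse :: "nat \<Rightarrow> nat list ugraph" where
  "hasse N = (hook_bounded N,
     {{l, m} | l m. l \<in> hook_bounded N \<and> m \<in> hook_bounded N \<and> covers l m})"

text \<open>The pending vertices of the Hasse graph: the empty partition and the rectangles
  with \<open>N - j\<close> parts equal to \<open>j\<close>.\<close>

definition hasse_boundary :: "nat \<Rightarrow> nat list set" where
  "hasse_boundary N = insert [] ((\<lambda>j. replicate (N - j) j) ` {1..N - 1})"

section \<open>The injective hull of a finite metric space\<close>

text \<open>The points of the finite metric space are labelled by a finite type \<open>'n\<close>, and
  \<open>d\<close> is the metric in terms of the labels.\<close>

definition hull_polyhedron :: "('n::finite \<Rightarrow> 'n \<Rightarrow> real) \<Rightarrow> (real ^ 'n) set" where
  "hull_polyhedron d = {f. \<forall>x y. f $ x + f $ y \<ge> d x y}"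

definition injective_hull :: "('n::finite \<Rightarrow> 'n \<Rightarrow> real) \<Rightarrow> (real ^ 'n) set" where
  "injective_hull d = {f \<in> hull_polyhedron d. \<forall>x. \<exists>y. f $ x + f $ y = d x y}"

definition hull_faces :: "('n::finite \<Rightarrow> 'n \<Rightarrow> real) \<Rightarrow> (real ^ 'n) set set" where
  "hull_faces d = {F. F face_of hull_polyhedron d \<and> bounded F \<and> F \<noteq> {}}"

text \<open>The vertices are the 0-faces (as singleton sets); each 1-face is a segment
  and contributes the edge consisting of the two 0-faces contained in it.\<close>

definition hull_skeleton_graph :: "('n::finite \<Rightarrow> 'n \<Rightarrow> real) \<Rightarrow> (real ^ 'n) set ugraph" where
  "hull_skeleton_graph d =
     ({F \<in> hull_faces d. aff_dim F = 0},
      (\<lambda>F. {v \<in> hull_faces d. aff_dim v = 0 \<and> v \<subseteq> F}) ` {F \<in> hull_faces d. aff_dim F = 1})"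

lemma Union_hull_faces:
  fixes d :: "'n::finite \<Rightarrow> 'n \<Rightarrow> real"
  assumes diag: "\<And>x. d x x = 0" and sym: "\<And>x y. d x y = d y x"
  shows "\<Union>(hull_faces d) = injective_hull d"
proof (intro equalityI subsetI)
  fix f assume "f \<in> \<Union>(hull_faces d)"
  then obtain F where F: "F face_of hull_polyhedron d" "bounded F" "f \<in> F"
    by (auto simp: hull_faces_def)
  have fD: "f \<in> hull_polyhedron d" using F face_of_imp_subset by blast
  have "\<exists>y. f $ x + f $ y = d x y" for x
  proof (rule ccontr)
    assume "\<nexists>y. f $ x + f $ y = d x y"
    then have pos: "f $ x + f $ y - d x y > 0" for y
      using fD by (auto simp: hull_polyhedron_def less_le)
    define e where "e = Min (range (\<lambda>y. f $ x + f $ y - d x y)) / 2"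
    have e0: "e > 0" unfolding e_def using pos by auto
    have "Min (range (\<lambda>y. f $ x + f $ y - d x y)) \<le> f $ x + f $ y - d x y" for y
      by (rule Min_le) auto
    then have e2: "2 * e \<le> f $ x + f $ y - d x y" for y unfolding e_def by simp
    have in_D: "f + t *\<^sub>R axis x 1 \<in> hull_polyhedron d" if "t \<ge> - e" for t
    proof -
      have "d u v \<le> (f + t *\<^sub>R axis x 1) $ u + (f + t *\<^sub>R axis x 1) $ v" for u v
      proof -
        have "d u v \<le> f $ u + f $ v"
          using fD by (auto simp: hull_polyhedron_def)
        then show ?thesis
          using that e0 e2[of u] e2[of v] sym[of u v] by (auto simp: axis_def)
      qed
      then show ?thesis by (simp add: hull_polyhedron_def)
    qed
    have ray: "f + t *\<^sub>R axis x 1 \<in> F" if "t > 0" for t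
    proof -
      have "f \<in> open_segment (f + (- e) *\<^sub>R axis x 1) (f + t *\<^sub>R axis x 1)"
      proof -
        have "(1 - e / (e + t)) * (- e) + e / (e + t) * t = 0"
          using e0 that by (simp add: field_simps)
        moreover have "(1 - u) *\<^sub>R (f + (- e) *\<^sub>R axis x 1) + u *\<^sub>R (f + t *\<^sub>R axis x 1)
            = f + ((1 - u) * (- e) + u * t) *\<^sub>R axis x 1" for u
          by (simp add: algebra_simps)
        ultimately have "f = (1 - e / (e + t)) *\<^sub>R (f + (- e) *\<^sub>R axis x 1)
                  + (e / (e + t)) *\<^sub>R (f + t *\<^sub>R axis x 1)"
          by simp
        moreover have "0 < e / (e + t)" "e / (e + t) < 1" using e0 that by auto
        moreover have "f + (- e) *\<^sub>R axis x 1 \<noteq> f + t *\<^sub>R axis x 1"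
          using e0 that by (auto simp: vec_eq_iff axis_def intro!: exI[of _ x])
        ultimately show ?thesis unfolding in_segment by blast
      qed
      then show ?thesis
        using face_ofD[OF F(1) _ in_D in_D F(3), of "- e" t] e0 that by simp
    qed
    obtain B where B: "\<And>g. g \<in> F \<Longrightarrow> norm g \<le> B"
      using F(2) by (auto simp: bounded_iff)
    have "B \<ge> 0" using B[OF F(3)] norm_ge_zero order_trans by blast
    define t where "t = B + norm f + 1"
    have "t > 0" using \<open>B \<ge> 0\<close> by (simp add: t_def add_nonneg_pos)
    then have "norm (f + t *\<^sub>R axis x 1) \<le> B" using ray B by blast
    moreover have "norm (t *\<^sub>R axis x 1 :: real ^ 'n) = t" using \<open>t > 0\<close> by simp
    moreover have "norm (t *\<^sub>R axis x 1 :: real ^ 'n) \<le> norm (f + t *\<^sub>R axis x 1) + norm f"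
      using norm_triangle_ineq4[of "f + t *\<^sub>R axis x 1" f] by (simp only: add_diff_cancel_left')
    ultimately show False unfolding t_def by linarith
  qed
  then show "f \<in> injective_hull d" using fD by (simp add: injective_hull_def)
next
  fix f assume f: "f \<in> injective_hull d"
  define F where "F = {g \<in> hull_polyhedron d.
    \<forall>x y. f $ x + f $ y = d x y \<longrightarrow> g $ x + g $ y = d x y}"
  have conv: "d x y \<le> (1 - u) * p + u * q" if "d x y \<le> p" "d x y \<le> q" "0 \<le> u" "u \<le> 1"
    for x y p q and u :: real
  proof -
    have "(1 - u) * d x y \<le> (1 - u) * p" "u * d x y \<le> u * q"
      using that by (auto intro: mult_left_mono)
    then show ?thesis by (simp add: algebra_simps)
  qed
  have ends: "p = c \<and> q = c"
    if "(1 - u) * p + u * q = c" "c \<le> p" "c \<le> q" "0 < u" "u < 1" for p q u c :: real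
  proof -
    have "(1 - u) * (p - c) + u * (q - c) = 0" using that(1) by (simp add: algebra_simps)
    moreover have "0 \<le> (1 - u) * (p - c)" "0 \<le> u * (q - c)" using that by auto
    ultimately have "(1 - u) * (p - c) = 0" "u * (q - c) = 0" by linarith+
    then show ?thesis using that by auto
  qed
  have split: "((1 - u) *\<^sub>R a + u *\<^sub>R b) $ x + ((1 - u) *\<^sub>R a + u *\<^sub>R b) $ y
      = (1 - u) * (a $ x + a $ y) + u * (b $ x + b $ y)" for a b :: "real ^ 'n" and u x y
    by (simp add: algebra_simps)
  have "convex F"
    unfolding convex_alt
  proof (intro ballI allI impI)
    fix a b u assume "a \<in> F" "b \<in> F" "0 \<le> u \<and> u \<le> (1 :: real)"
    moreover have "(1 - u) * c + u * c = c" for c :: real by (simp add: algebra_simps)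
    ultimately show "(1 - u) *\<^sub>R a + u *\<^sub>R b \<in> F"
      unfolding F_def hull_polyhedron_def mem_Collect_eq split by (simp add: conv)
  qed
  moreover have "a \<in> F \<and> b \<in> F"
    if "a \<in> hull_polyhedron d" "b \<in> hull_polyhedron d" "g \<in> F" "g \<in> open_segment a b" for a b g
  proof -
    obtain u where u: "0 < u" "u < 1" "g = (1 - u) *\<^sub>R a + u *\<^sub>R b"
      using \<open>g \<in> open_segment a b\<close> by (auto simp: in_segment)
    have "a $ x + a $ y = d x y \<and> b $ x + b $ y = d x y" if "f $ x + f $ y = d x y" for x y
    proof (rule ends)
      show "(1 - u) * (a $ x + a $ y) + u * (b $ x + b $ y) = d x y"
        using \<open>g \<in> F\<close> that unfolding F_def u(3) mem_Collect_eq split by blast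
    qed (use u \<open>a \<in> hull_polyhedron d\<close> \<open>b \<in> hull_polyhedron d\<close> in
        \<open>auto simp: hull_polyhedron_def\<close>)
    then show ?thesis using that by (auto simp: F_def)
  qed
  moreover have "F \<subseteq> hull_polyhedron d" by (simp add: F_def)
  ultimately have "F face_of hull_polyhedron d" unfolding face_of_def by blast
  moreover have "bounded F"
  proof -
    obtain m where m: "\<And>x. f $ x + f $ m x = d x (m x)"
      using f unfolding injective_hull_def by (auto dest!: choice)
    have "norm g \<le> (\<Sum>x\<in>UNIV. d x (m x))" if "g \<in> F" for g
    proof -
      have nonneg: "g $ x \<ge> 0" for x
      proof -
        have "d x x \<le> g $ x + g $ x" using that unfolding F_def hull_polyhedron_def by blast
        then show ?thesis by (simp add: diag)
      qed
      have "\<bar>g $ x\<bar> \<le> d x (m x)" for x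
      proof -
        have "g $ x + g $ m x = d x (m x)" using that m by (auto simp: F_def)
        then show ?thesis using nonneg[of x] nonneg[of "m x"] by simp
      qed
      then have "(\<Sum>x\<in>UNIV. \<bar>g $ x\<bar>) \<le> (\<Sum>x\<in>UNIV. d x (m x))" by (intro sum_mono)
      then show ?thesis using norm_le_l1_cart[of g] by linarith
    qed
    then show ?thesis by (auto simp: bounded_iff)
  qed
  moreover have "f \<in> F" using f by (simp add: F_def injective_hull_def)
  ultimately show "f \<in> \<Union>(hull_faces d)" by (auto simp: hull_faces_def)
qed

end

theory Submission
  imports Defs
begin

text \<open>The distance of two partitions in the Hasse graph is the size of the symmetric difference of
  their diagrams, and the boundary points are the rectangles \<open>R\<^sub>k\<close> with \<open>N - k\<close> rows and \<open>k\<close> columns, where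
  \<open>R\<^sub>0\<close> is empty. A diagram \<open>D\<close> gives the point \<open>v D\<close> of the polyhedron with the distances from \<open>D\<close> to the
  rectangles as coordinates; the inequality for \<open>i, j\<close> is tight at \<open>v D\<close> iff
  \<open>R\<^sub>i \<inter> R\<^sub>j \<subseteq> D \<subseteq> R\<^sub>i \<union> R\<^sub>j\<close>.

  Strict four-point inequalities on the circle of rectangles show that for every point \<open>f\<close> of the
  polyhedron the union of the \<open>R\<^sub>i \<inter> R\<^sub>j\<close> over the pairs tight at \<open>f\<close> is a diagram \<open>D\<close> such that \<open>v D\<close> is
  tight wherever \<open>f\<close> is. As \<open>v D\<close> then lies in every face containing \<open>f\<close>, all extreme points have
  the form \<open>v D\<close>. If \<open>D\<close> covers \<open>E\<close> or equals \<open>E\<close>, then only \<open>D\<close> and \<open>E\<close> are tight wherever both \<open>v D\<close>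
  and \<open>v E\<close> are, so by Krein--Milman the segment from \<open>v D\<close> to \<open>v E\<close> is a face. Conversely, any
  diagram between \<open>D \<inter> E\<close> and \<open>D \<union> E\<close> belongs to the face spanned by \<open>v D\<close> and \<open>v E\<close>, so that
  an edge admits no such diagram besides \<open>D\<close> and \<open>E\<close>, and these form a covering pair.\<close>

section \<open>Symmetric differences\<close>

text \<open>The last set is where \<open>C\<close> differs from both \<open>A\<close> and
  \<open>B\<close>, so it is counted twice; points of \<open>sym_diff A B\<close> are counted once.
  This makes the excess in the triangle inequality explicit and yields its equality case.\<close>

lemma card_sym_diff_via:
  assumes "finite A" "finite B" "finite C"
  shows "card (sym_diff C A) + card (sym_diff C B)
       = card (sym_diff A B) + 2 * card ((A \<inter> B - C) \<union> (C - (A \<union> B)))"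
proof -
  let ?W = "(A \<inter> B - C) \<union> (C - (A \<union> B))"
  have "card (sym_diff C A) + card (sym_diff C B)
      = card (sym_diff C A \<union> sym_diff C B) + card (sym_diff C A \<inter> sym_diff C B)"
    using assms by (intro card_Un_Int) auto
  also have "sym_diff C A \<union> sym_diff C B = sym_diff A B \<union> ?W" by auto
  also have "card (sym_diff A B \<union> ?W) = card (sym_diff A B) + card ?W"
    using assms by (intro card_Un_disjoint) auto
  also have "sym_diff C A \<inter> sym_diff C B = ?W" by auto
  finally show ?thesis by simp
qed

lemma card_sym_diff_triangle:
  assumes "finite A" "finite B" "finite C"
  shows "card (sym_diff A B) \<le> card (sym_diff C A) + card (sym_diff C B)"
  using card_sym_diff_via[OF assms] by simp

lemma card_sym_diff_eq_iff:
  assumes "finite A" "finite B" "finite C"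
  shows "card (sym_diff C A) + card (sym_diff C B) = card (sym_diff A B)
     \<longleftrightarrow> A \<inter> B \<subseteq> C \<and> C \<subseteq> A \<union> B"
proof -
  have "finite ((A \<inter> B - C) \<union> (C - (A \<union> B)))" using assms by auto
  then have "card ((A \<inter> B - C) \<union> (C - (A \<union> B))) = 0 \<longleftrightarrow> A \<inter> B \<subseteq> C \<and> C \<subseteq> A \<union> B"
    by auto
  then show ?thesis using card_sym_diff_via[OF assms] by linarith
qed

lemma card_sym_diff_Int:
  assumes "finite A" "finite B"
  shows "card (sym_diff A B) + 2 * card (A \<inter> B) = card A + card B"
  using card_sym_diff_via[of A B "{}"] assms by simp

lemma finite_down_closed_nat:
  fixes S :: "nat set"
  assumes "finite S" "\<And>a b. a \<in> S \<Longrightarrow> b \<le> a \<Longrightarrow> b \<in> S"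
  shows "S = {..<card S}"
proof -
  obtain n where n: "n \<notin> S" "\<And>m. m < n \<Longrightarrow> m \<in> S"
    using ex_least_nat_le[of "\<lambda>n. n \<notin> S"] ex_new_if_finite[OF _ assms(1)]
    by (metis infinite_UNIV_nat linorder_not_less exists_least_iff)
  then have "S = {..<n}" using assms(2) by (metis lessThan_iff linorder_not_less subsetI subset_antisym)
  then show ?thesis by simp
qed

section \<open>Diagrams of bounded hook length\<close>

text \<open>The longest hook is the one at \<open>(0, 0)\<close>, of length rows plus columns minus
  1. With \<open>a + 1\<close> rows and \<open>b' + 1\<close> columns the second condition says that
  this is below \<open>N\<close>.\<close>

definition hook_ideals :: "nat \<Rightarrow> (nat \<times> nat) set set" where
  "hook_ideals N = {D. (\<forall>a b a' b'. (a, b) \<in> D \<longrightarrow> a' \<le> a \<longrightarrow> b' \<le> b \<longrightarrow> (a', b') \<in> D) \<and>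
     (\<forall>a b a' b'. (a, b) \<in> D \<longrightarrow> (a', b') \<in> D \<longrightarrow> a + b' + 2 \<le> N)}"

lemma hook_ideals_down:
  "D \<in> hook_ideals N \<Longrightarrow> (a, b) \<in> D \<Longrightarrow> a' \<le> a \<Longrightarrow> b' \<le> b \<Longrightarrow> (a', b') \<in> D"
  unfolding hook_ideals_def by blast

lemma hook_ideals_bound:
  "D \<in> hook_ideals N \<Longrightarrow> (a, b) \<in> D \<Longrightarrow> (a', b') \<in> D \<Longrightarrow> a + b' + 2 \<le> N"
  unfolding hook_ideals_def by blast

lemma hook_ideals_finite:
  assumes "D \<in> hook_ideals N"
  shows "finite D"
proof -
  have "D \<subseteq> {..<N} \<times> {..<N}"
    using hook_ideals_bound[OF assms] by fastforce
  then show ?thesis by (rule finite_subset) simp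
qed

section \<open>Partitions and their diagrams\<close>

lemma in_young_diagram: "(i, j) \<in> young_diagram l \<longleftrightarrow> i < length l \<and> j < l ! i"
  by (simp add: young_diagram_def)

lemma young_diagram_finite: "finite (young_diagram l)"
proof -
  have "young_diagram l = (SIGMA i:{..<length l}. {..<l ! i})"
    by (auto simp: young_diagram_def)
  then show ?thesis by simp
qed

lemma young_diagram_down:
  assumes "is_partition l" "(a, b) \<in> young_diagram l" "a' \<le> a" "b' \<le> b"
  shows "(a', b') \<in> young_diagram l"
proof -
  have "l ! a \<le> l ! a'"
    using assms by (cases "a' = a") (auto simp: is_partition_def in_young_diagram sorted_wrt_iff_nth_less)
  then show ?thesis using assms by (auto simp: in_young_diagram)
qed

lemma partition_nth_pos: "is_partition l \<Longrightarrow> i < length l \<Longrightarrow> 0 < l ! i"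
  by (metis is_partition_def nth_mem gr0I)

lemma young_diagram_in_hook_ideals:
  assumes "l \<in> hook_bounded N"
  shows "young_diagram l \<in> hook_ideals N"
proof -
  have l: "is_partition l" and hl: "\<And>c. c \<in> young_diagram l \<Longrightarrow> card (hook l c) < N"
    using assms by (auto simp: hook_bounded_def hook_length_def)
  have "a + b' + 2 \<le> N" if ab: "(a, b) \<in> young_diagram l" "(a', b') \<in> young_diagram l" for a b a' b'
  proof -
    \<comment> \<open>The first column down to row \<open>a\<close>, and the first row out to column
      \<open>b'\<close> without the corner, so that the two are disjoint.\<close>
    let ?C = "(\<lambda>i. (i, 0 :: nat)) ` {..a}" and ?R = "(\<lambda>j. (0 :: nat, j)) ` {1..b'}"
    have "?C \<union> ?R \<subseteq> hook l (0, 0)"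
      using young_diagram_down[OF l ab(1)] young_diagram_down[OF l ab(2)] by (auto simp: hook_def)
    moreover have "finite (hook l (0, 0))"
      by (rule finite_subset[OF _ young_diagram_finite]) (auto simp: hook_def)
    ultimately have "card (?C \<union> ?R) \<le> card (hook l (0, 0))" by (intro card_mono)
    moreover have "card (?C \<union> ?R) = card ?C + card ?R"
      by (intro card_Un_disjoint) auto
    moreover have "card ?C = Suc a" "card ?R = b'" by (auto simp: card_image inj_on_def)
    moreover have "card (hook l (0, 0)) < N"
      using young_diagram_down[OF l ab(1)] by (intro hl) auto
    ultimately show ?thesis by linarith
  qed
  then show ?thesis using young_diagram_down[OF l] unfolding hook_ideals_def by blast
qed

lemma in_hook_bounded_if:
  assumes "is_partition l" "young_diagram l \<in> hook_ideals N"
  shows "l \<in> hook_bounded N"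
proof -
  have "card (hook l (i, j)) < N" if "(i, j) \<in> young_diagram l" for i j
  proof -
    have ij: "i < length l" "j < l ! i" using that by (auto simp: in_young_diagram)
    \<comment> \<open>The ends of the first column and of row \<open>i\<close>; the bound for this
      pair limits leg and arm together.\<close>
    have "(length l - 1, 0) \<in> young_diagram l" "(i, l ! i - 1) \<in> young_diagram l"
      using ij partition_nth_pos[OF assms(1), of "length l - 1"] by (auto simp: in_young_diagram)
    from hook_ideals_bound[OF assms(2) this] have le: "length l + l ! i \<le> N"
      using ij by linarith
    have "hook l (i, j) \<subseteq> (\<lambda>i'. (i', j)) ` {i..<length l} \<union> (\<lambda>j'. (i, j')) ` {Suc j..<l ! i}"
    proof
      fix p assume "p \<in> hook l (i, j)"
      then obtain i' j' where p: "p = (i', j')" "i' < length l" "j' < l ! i'"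
        "i' = i \<and> j \<le> j' \<or> j' = j \<and> i \<le> i'"
        by (auto simp: hook_def in_young_diagram)
      then show "p \<in> (\<lambda>i'. (i', j)) ` {i..<length l} \<union> (\<lambda>j'. (i, j')) ` {Suc j..<l ! i}"
        using ij by (cases "j' = j") auto
    qed
    then have "card (hook l (i, j))
        \<le> card ((\<lambda>i'. (i', j)) ` {i..<length l} \<union> (\<lambda>j'. (i, j')) ` {Suc j..<l ! i})"
      by (intro card_mono) auto
    also have "\<dots> \<le> card ((\<lambda>i'. (i', j)) ` {i..<length l}) + card ((\<lambda>j'. (i, j')) ` {Suc j..<l ! i})"
      by (rule card_Un_le)
    also have "\<dots> = (length l - i) + (l ! i - Suc j)" by (simp add: card_image inj_on_def)
    finally show ?thesis using ij le by linarith
  qed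
  then show ?thesis using assms(1) by (auto simp: hook_bounded_def hook_length_def)
qed

lemma partition_eqI:
  assumes "is_partition l" "is_partition m" and eq: "young_diagram l = young_diagram m"
  shows "l = m"
proof -
  have "i < length l \<longleftrightarrow> i < length m" for i
    using partition_nth_pos[OF assms(1), of i] partition_nth_pos[OF assms(2), of i]
      eq[unfolded set_eq_iff, rule_format, of "(i, 0)"] by (auto simp: in_young_diagram)
  then have len: "length l = length m" by (metis linorder_neq_iff)
  have "l ! i = m ! i" if "i < length l" for i
  proof -
    have "j < l ! i \<longleftrightarrow> j < m ! i" for j
      using eq[unfolded set_eq_iff, rule_format, of "(i, j)"] that len by (auto simp: in_young_diagram)
    then show ?thesis by (metis linorder_neq_iff)
  qed
  then show ?thesis using len by (simp add: list_eq_iff_nth_eq)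
qed

text \<open>The parts are the row sizes; cutting the list at the size of the first column leaves out
  the empty rows.\<close>

lemma hook_ideals_young_diagram:
  assumes D: "D \<in> hook_ideals N"
  obtains l where "l \<in> hook_bounded N" "young_diagram l = D"
proof -
  define w where "w i = card {j. (i, j) \<in> D}" for i
  define h where "h = card {i. (i, 0) \<in> D}"
  define l where "l = map w [0..<h]"
  have row: "{j. (i, j) \<in> D} = {..<w i}" for i
    unfolding w_def
  proof (rule finite_down_closed_nat)
    have "{j. (i, j) \<in> D} \<subseteq> snd ` D" by force
    then show "finite {j. (i, j) \<in> D}"
      using hook_ideals_finite[OF D] by (metis finite_imageI finite_subset)
  qed (use hook_ideals_down[OF D] in blast)
  have col: "{i. (i, 0) \<in> D} = {..<h}"
    unfolding h_def
  proof (rule finite_down_closed_nat)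
    have "{i. (i, 0) \<in> D} \<subseteq> fst ` D" by force
    then show "finite {i. (i, 0) \<in> D}"
      using hook_ideals_finite[OF D] by (metis finite_imageI finite_subset)
  qed (use hook_ideals_down[OF D] in blast)
  have mem: "(i, j) \<in> D \<longleftrightarrow> i < h \<and> j < w i" for i j
    using row[of i] col hook_ideals_down[OF D, of i j i 0] by blast
  have dia: "young_diagram l = D"
    by (auto simp: in_young_diagram l_def mem)
  have anti: "w j \<le> w i" if "i \<le> j" for i j
  proof -
    have "{..<w j} \<subseteq> {..<w i}"
      unfolding row[symmetric] using hook_ideals_down[OF D _ that] by blast
    then show ?thesis by auto
  qed
  have "0 < w i" if "i < h" for i
    using col row[of i] that by blast
  then have "is_partition l"
    unfolding is_partition_def l_def by (fastforce simp: sorted_wrt_iff_nth_less intro: anti)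
  then show ?thesis using that in_hook_bounded_if D dia by blast
qed

lemma bij_betw_young_diagram: "bij_betw young_diagram (hook_bounded N) (hook_ideals N)"
  unfolding bij_betw_def
proof
  show "inj_on young_diagram (hook_bounded N)"
    by (rule inj_onI) (auto intro: partition_eqI simp: hook_bounded_def)
  show "young_diagram ` hook_bounded N = hook_ideals N"
    by (auto intro: young_diagram_in_hook_ideals elim: hook_ideals_young_diagram)
qed

text \<open>A box of \<open>D - E\<close> with maximal \<open>a + b\<close> can be removed: any box
  of \<open>D\<close> to its lower right is also outside the down-closed \<open>E\<close>, so
  maximality makes it the same box.\<close>

lemma hook_ideals_remove:
  assumes D: "D \<in> hook_ideals N" and E: "E \<in> hook_ideals N" and ne: "\<not> D \<subseteq> E"
  obtains p where "p \<in> D - E" "D - {p} \<in> hook_ideals N"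
proof -
  have "finite (D - E)" "D - E \<noteq> {}" using hook_ideals_finite[OF D] ne by auto
  \<comment> \<open>Negation, and hence \<open>int\<close>, turns the minimum into a
    maximum.\<close>
  from ex_is_arg_min_if_finite[OF this, of "\<lambda>(a, b). - int (a + b)"]
  obtain r c where rc: "(r, c) \<in> D - E" and max: "\<And>a b. (a, b) \<in> D - E \<Longrightarrow> a + b \<le> r + c"
    by (force simp: is_arg_min_linorder)
  then have "(a, b) = (r, c)" if "(a, b) \<in> D" "r \<le> a" "c \<le> b" for a b
    using that hook_ideals_down[OF E, of a b r c] max[of a b] rc by (cases "(a, b) \<in> E") force+
  then have "D - {(r, c)} \<in> hook_ideals N"
    using hook_ideals_down[OF D] hook_ideals_bound[OF D]
    unfolding hook_ideals_def by blast
  then show ?thesis using that rc by blast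
qed

text \<open>Dually, a box of \<open>E - D\<close> with minimal \<open>a + b\<close> can be added.
  The hook bound is inherited from \<open>E\<close>, which contains the enlarged set.\<close>

lemma hook_ideals_insert:
  assumes D: "D \<in> hook_ideals N" and E: "E \<in> hook_ideals N" and ne: "D \<subset> E"
  obtains p where "p \<in> E - D" "insert p D \<in> hook_ideals N"
proof -
  have "finite (E - D)" "E - D \<noteq> {}" using hook_ideals_finite[OF E] ne by auto
  from ex_is_arg_min_if_finite[OF this, of "\<lambda>(a, b). a + b"]
  obtain r c where rc: "(r, c) \<in> E - D" and min: "\<And>a b. (a, b) \<in> E - D \<Longrightarrow> r + c \<le> a + b"
    by (force simp: is_arg_min_linorder)
  have "(a, b) = (r, c) \<or> (a, b) \<in> D" if "a \<le> r" "b \<le> c" for a b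
    using that hook_ideals_down[OF E, of r c a b] min[of a b] rc by auto
  then have "(a', b') \<in> insert (r, c) D" if "(a, b) \<in> insert (r, c) D" "a' \<le> a" "b' \<le> b" for a b a' b'
    using that hook_ideals_down[OF D, of a b a' b'] by (cases "(a, b) = (r, c)") auto
  moreover have "insert (r, c) D \<subseteq> E" using rc ne by blast
  then have "a + b' + 2 \<le> N" if "(a, b) \<in> insert (r, c) D" "(a', b') \<in> insert (r, c) D" for a b a' b'
    using hook_ideals_bound[OF E, of a b a' b'] that by blast
  ultimately have "insert (r, c) D \<in> hook_ideals N"
    unfolding hook_ideals_def mem_Collect_eq by (intro conjI allI impI) metis+
  then show ?thesis using that rc by blast
qed

text \<open>The corner condition is automatic: a box of \<open>l\<close> below or to the right of
  the removed one would lie in \<open>m\<close> and force the removed box into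
  \<open>m\<close>.\<close>

lemma covers_iff:
  assumes "l \<in> hook_bounded N" "m \<in> hook_bounded N"
  shows "covers l m \<longleftrightarrow> (\<exists>p\<in>young_diagram l. young_diagram m = young_diagram l - {p})"
proof
  assume "covers l m"
  then show "\<exists>p\<in>young_diagram l. young_diagram m = young_diagram l - {p}"
    by (auto simp: covers_def inner_corner_def)
next
  assume "\<exists>p\<in>young_diagram l. young_diagram m = young_diagram l - {p}"
  then obtain r c where rc: "(r, c) \<in> young_diagram l" "young_diagram m = young_diagram l - {(r, c)}"
    by auto
  have m: "is_partition m" using assms by (simp add: hook_bounded_def)
  have "(Suc r, c) \<notin> young_diagram l" "(r, Suc c) \<notin> young_diagram l"
    using young_diagram_down[OF m, of "Suc r" c r c] young_diagram_down[OF m, of r "Suc c" r c] rc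
    by auto
  then show "covers l m" using rc by (auto simp: covers_def inner_corner_def)
qed

section \<open>The path metric\<close>

text \<open>Each edge changes a single box, so the bound follows from the triangle
  inequality.\<close>

lemma hasse_walk_ge:
  assumes "(u, v) \<in> {(a, b). {a, b} \<in> snd (hasse N)} ^^ n"
  shows "card (sym_diff (young_diagram u) (young_diagram v)) \<le> n"
  using assms
proof (induction n arbitrary: v)
  case (Suc n)
  then obtain w where w: "(u, w) \<in> {(a, b). {a, b} \<in> snd (hasse N)} ^^ n" "{w, v} \<in> snd (hasse N)"
    by auto
  from w(2) have "\<exists>p. sym_diff (young_diagram w) (young_diagram v) \<subseteq> {p}"
    by (auto simp: hasse_def covers_def doubleton_eq_iff)
  then have "card (sym_diff (young_diagram w) (young_diagram v)) \<le> 1"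
    by (metis card.empty card.insert card_mono empty_iff finite.emptyI finite.insertI One_nat_def)
  moreover have "card (sym_diff (young_diagram u) (young_diagram v))
     \<le> card (sym_diff (young_diagram w) (young_diagram u)) + card (sym_diff (young_diagram w) (young_diagram v))"
    by (intro card_sym_diff_triangle young_diagram_finite)
  moreover have "sym_diff (young_diagram w) (young_diagram u) = sym_diff (young_diagram u) (young_diagram w)"
    by auto
  ultimately show ?case using Suc.IH[OF w(1)] by simp
qed simp

lemma hasse_edge:
  assumes "l \<in> hook_bounded N" "m \<in> hook_bounded N" "p \<in> young_diagram l"
    "young_diagram m = young_diagram l - {p}"
  shows "{l, m} \<in> snd (hasse N)"
  using assms covers_iff[OF assms(1,2)] by (auto simp: hasse_def)

text \<open>Each step corrects one box: first the boxes outside the target are removed, then the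
  missing ones are added. In this order no diagram on the way violates the hook bound.\<close>

lemma hasse_walk_exists:
  assumes "u \<in> hook_bounded N" "v \<in> hook_bounded N"
  shows "(u, v) \<in> {(a, b). {a, b} \<in> snd (hasse N)} ^^ card (sym_diff (young_diagram u) (young_diagram v))"
  using assms
proof (induction "card (sym_diff (young_diagram u) (young_diagram v))" arbitrary: u)
  case 0
  then have "young_diagram u = young_diagram v" by (auto simp: young_diagram_finite)
  then show ?case using 0 partition_eqI by (auto simp: hook_bounded_def)
next
  case (Suc n)
  let ?U = "young_diagram u" and ?V = "young_diagram v"
  have U: "?U \<in> hook_ideals N" and V: "?V \<in> hook_ideals N"
    using Suc.prems young_diagram_in_hook_ideals by auto
  obtain w p where w: "w \<in> hook_bounded N" "{u, w} \<in> snd (hasse N)"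
    "p \<in> sym_diff ?U ?V" "sym_diff (young_diagram w) ?V = sym_diff ?U ?V - {p}"
  proof (cases "?U \<subseteq> ?V")
    case False
    from hook_ideals_remove[OF U V this] obtain p where p: "p \<in> ?U - ?V" "?U - {p} \<in> hook_ideals N"
      by blast
    obtain w where w: "w \<in> hook_bounded N" "young_diagram w = ?U - {p}"
      using hook_ideals_young_diagram[OF p(2)] by blast
    have "{u, w} \<in> snd (hasse N)"
      by (rule hasse_edge[OF Suc.prems(1) w(1), of p]) (use w(2) p(1) in auto)
    moreover have "sym_diff (young_diagram w) ?V = sym_diff ?U ?V - {p}"
      unfolding w(2) using p(1) by blast
    ultimately show ?thesis using that[of w p] w(1) p(1) by blast
  next
    case True
    then have "?U \<subset> ?V" using Suc.hyps(2) by auto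
    from hook_ideals_insert[OF U V this] obtain p where p: "p \<in> ?V - ?U" "insert p ?U \<in> hook_ideals N"
      by blast
    obtain w where w: "w \<in> hook_bounded N" "young_diagram w = insert p ?U"
      using hook_ideals_young_diagram[OF p(2)] by blast
    have "{w, u} \<in> snd (hasse N)"
      by (rule hasse_edge[OF w(1) Suc.prems(1), of p]) (use w(2) p(1) in auto)
    then have "{u, w} \<in> snd (hasse N)" by (simp add: insert_commute)
    moreover have "sym_diff (young_diagram w) ?V = sym_diff ?U ?V - {p}"
      unfolding w(2) using p(1) by blast
    ultimately show ?thesis using that[of w p] w(1) p(1) by blast
  qed
  have "card (sym_diff (young_diagram w) ?V) = n"
    using w(3) Suc.hyps(2) by (simp only: w(4) card_Diff_singleton)
  then have "(w, v) \<in> {(a, b). {a, b} \<in> snd (hasse N)} ^^ n"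
    using Suc.hyps(1)[of w] Suc.prems w(1) by metis
  then have "(u, v) \<in> {(a, b). {a, b} \<in> snd (hasse N)} ^^ Suc n"
    using w(2) by (intro relpow_Suc_I2) auto
  then show ?case using Suc.hyps(2) by simp
qed

lemma graph_dist_hasse:
  assumes "u \<in> hook_bounded N" "v \<in> hook_bounded N"
  shows "graph_dist (hasse N) u v = card (sym_diff (young_diagram u) (young_diagram v))"
  unfolding graph_dist_def
  by (rule Least_equality) (use hasse_walk_exists[OF assms] hasse_walk_ge in blast)+

section \<open>Rectangles and geodesics between them\<close>

definition rect :: "nat \<Rightarrow> nat \<Rightarrow> (nat \<times> nat) set" where
  "rect N k = {..<N - k} \<times> {..<k}"

lemma in_rect: "(a, b) \<in> rect N k \<longleftrightarrow> a < N - k \<and> b < k"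
  by (simp add: rect_def)

lemma finite_rect: "finite (rect N k)"
  by (simp add: rect_def)

lemma rect_in_hook_ideals: "rect N k \<in> hook_ideals N"
  by (auto simp: hook_ideals_def in_rect)

text \<open>Index \<open>N\<close> is a second name for the empty rectangle. It closes the circle
  and gives \<open>N - r\<close> a meaning at \<open>r = 0\<close>.\<close>

lemma rect_N: "rect N N = rect N 0"
  by (simp add: rect_def)

text \<open>The case \<open>k = 0\<close> is separate because \<open>replicate N 0\<close> would
  have zero parts.\<close>

definition rect_partition :: "nat \<Rightarrow> nat \<Rightarrow> nat list" where
  "rect_partition N k = (if k = 0 then [] else replicate (N - k) k)"

lemma young_diagram_rect_partition: "young_diagram (rect_partition N k) = rect N k"
  by (auto simp: rect_partition_def in_young_diagram in_rect)

lemma rect_partition_in_hook_bounded: "rect_partition N k \<in> hook_bounded N"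
proof (rule in_hook_bounded_if)
  show "is_partition (rect_partition N k)"
    by (auto simp: is_partition_def rect_partition_def sorted_wrt_iff_nth_less)
qed (simp add: young_diagram_rect_partition rect_in_hook_ideals)

lemma hasse_boundary_eq:
  assumes "N > 0"
  shows "hasse_boundary N = rect_partition N ` {..<N}"
proof -
  have "{..<N} = insert 0 {1..N - 1}" using assms by auto
  moreover have "rect_partition N ` {1..N - 1} = (\<lambda>j. replicate (N - j) j) ` {1..N - 1}"
    by (intro image_cong) (auto simp: rect_partition_def)
  moreover have "rect_partition N 0 = []" by (simp add: rect_partition_def)
  ultimately show ?thesis by (simp add: hasse_boundary_def)
qed

section \<open>The metric on the rectangles\<close>

definition rect_dist :: "nat \<Rightarrow> nat \<Rightarrow> nat \<Rightarrow> real" where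
  "rect_dist N i j = real (card (sym_diff (rect N i) (rect N j)))"

lemma rect_dist_commute: "rect_dist N i j = rect_dist N j i"
  by (simp add: rect_dist_def Un_commute)

text \<open>With \<open>s = j - i\<close> the distance is \<open>s * (N - s)\<close>. It is
  unchanged when \<open>s\<close> becomes \<open>N - s\<close>, which is the rotational symmetry of
  \<open>N\<close> points on a circle.\<close>

lemma rect_dist_eq:
  assumes "i \<le> j" "j \<le> N"
  shows "rect_dist N i j = (real j - real i) * (real N - (real j - real i))"
proof -
  have "rect N i \<inter> rect N j = {..<N - j} \<times> {..<i}" using assms by (auto simp: rect_def)
  then have "card (sym_diff (rect N i) (rect N j)) + 2 * ((N - j) * i) = (N - i) * i + (N - j) * j"
    using card_sym_diff_Int[OF finite_rect finite_rect, of N i N j] by (simp add: rect_def)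
  then have "rect_dist N i j + 2 * ((real N - real j) * real i)
      = (real N - real i) * real i + (real N - real j) * real j"
    using assms unfolding rect_dist_def
    by (metis (mono_tags, lifting) of_nat_add of_nat_mult of_nat_diff of_nat_numeral le_trans)
  then show ?thesis by (simp add: algebra_simps)
qed

text \<open>The points \<open>0, \<dots>, N - 1\<close> lie on a circle, and crossing pairs of points are farther apart
  than parallel ones.\<close>

lemma rect_dist_nested:
  assumes "i < k" "k \<le> l" "l < j" "j \<le> N"
  shows "rect_dist N i j + rect_dist N k l < rect_dist N i l + rect_dist N k j"
proof -
  have "rect_dist N i l + rect_dist N k j - (rect_dist N i j + rect_dist N k l)
      = 2 * ((real k - real i) * (real j - real l))"
    using assms by (simp add: rect_dist_eq algebra_simps)
  moreover have "(real k - real i) * (real j - real l) > 0" using assms by simp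
  ultimately show ?thesis by linarith
qed

lemma rect_dist_apart:
  assumes "i \<le> j" "j < k" "k \<le> l" "l < N"
  shows "rect_dist N i j + rect_dist N k l < rect_dist N i k + rect_dist N j l"
proof -
  \<comment> \<open>The last factor is the length of the arc from \<open>l\<close> through
    \<open>N\<close> back to \<open>i\<close>; it is positive because \<open>l < N\<close>.\<close>
  have "rect_dist N i k + rect_dist N j l - (rect_dist N i j + rect_dist N k l)
      = 2 * ((real k - real j) * (real N - (real l - real i)))"
    using assms by (simp add: rect_dist_eq algebra_simps)
  moreover have "(real k - real j) * (real N - (real l - real i)) > 0" using assms by simp
  ultimately show ?thesis by linarith
qed

text \<open>This is equality in the triangle inequality through \<open>D\<close>, by
  \<open>card_sym_diff_eq_iff\<close>. As inclusions it passes to sets between two solutions and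
  depends on the rectangles only, not on their indices.\<close>

definition on_geodesic :: "nat \<Rightarrow> (nat \<times> nat) set \<Rightarrow> nat \<Rightarrow> nat \<Rightarrow> bool" where
  "on_geodesic N D i j \<longleftrightarrow> rect N i \<inter> rect N j \<subseteq> D \<and> D \<subseteq> rect N i \<union> rect N j"

lemma on_geodesic_iff:
  assumes "finite D"
  shows "on_geodesic N D i j \<longleftrightarrow>
    real (card (sym_diff D (rect N i))) + real (card (sym_diff D (rect N j))) = rect_dist N i j"
proof -
  have "on_geodesic N D i j \<longleftrightarrow>
      card (sym_diff D (rect N i)) + card (sym_diff D (rect N j)) = card (sym_diff (rect N i) (rect N j))"
    unfolding on_geodesic_def by (rule card_sym_diff_eq_iff[OF finite_rect finite_rect assms, symmetric])
  then show ?thesis unfolding rect_dist_def by linarith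
qed

lemma on_geodesic_commute: "on_geodesic N D i j \<longleftrightarrow> on_geodesic N D j i"
  by (auto simp: on_geodesic_def)

lemma on_geodesic_between:
  assumes "on_geodesic N D i j" "on_geodesic N E i j" "D \<inter> E \<subseteq> M" "M \<subseteq> D \<union> E"
  shows "on_geodesic N M i j"
  using assms unfolding on_geodesic_def by blast

text \<open>The pairs of rectangles with \<open>D\<close> on a geodesic between them correspond to the lattice points
  \<open>(r, c)\<close> on the boundary path of \<open>D\<close>.\<close>

lemma on_geodesicI:
  assumes D: "D \<in> hook_ideals N" and "r + c \<le> N" "(r, c) \<notin> D" "{..<r} \<times> {..<c} \<subseteq> D"
    and width: "\<And>a b. (a, b) \<in> D \<Longrightarrow> b < c \<Longrightarrow> a + c < N"
    and height: "\<And>a b. (a, b) \<in> D \<Longrightarrow> a < r \<Longrightarrow> b + r < N"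
  shows "on_geodesic N D c (N - r)"
proof -
  have "rect N c \<inter> rect N (N - r) \<subseteq> {..<r} \<times> {..<c}" using assms(2) by (auto simp: rect_def)
  \<comment> \<open>As \<open>(r, c)\<close> is not in \<open>D\<close>, every box has
    \<open>a < r\<close> or \<open>b < c\<close>; \<open>height\<close> and \<open>width\<close> put
    it into the second or the first rectangle.\<close>
  moreover have "(a, b) \<in> rect N c \<union> rect N (N - r)" if "(a, b) \<in> D" for a b
  proof -
    have "a < r \<or> b < c" using hook_ideals_down[OF D that, of r c] assms(3) by force
    then show ?thesis using width[OF that] height[OF that] assms(2) by (auto simp: in_rect)
  qed
  ultimately show ?thesis using assms(4) unfolding on_geodesic_def by (meson order_trans subrelI)
qed

text \<open>The case \<open>E = D\<close> is included, so that 0-faces and 1-faces are treated by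
  one argument.\<close>

locale near_cover =
  fixes N :: nat and D E :: "(nat \<times> nat) set" and p :: "nat \<times> nat"
  assumes D: "D \<in> hook_ideals N" and E: "E \<in> hook_ideals N"
    and ED: "E \<subseteq> D" and DE: "D \<subseteq> insert p E"
begin

text \<open>At most one of two distinct boxes of \<open>D\<close> is missing from \<open>E\<close>,
  and the other one already forces the rectangle into \<open>E\<close>.\<close>

lemma rect_below:
  assumes "(a, b) \<in> D" "(a', b') \<in> D" "(a, b) \<noteq> (a', b')" "r \<le> Suc a" "r \<le> Suc a'" "c \<le> Suc b" "c \<le> Suc b'"
  shows "{..<r} \<times> {..<c} \<subseteq> E"
proof -
  have "(a, b) \<in> E \<or> (a', b') \<in> E" using DE assms(1-3) by blast
  then show ?thesis using hook_ideals_down[OF E] assms(4-7) by fastforce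
qed

lemma both_on_geodesic:
  assumes "r + c \<le> N" "(r, c) \<notin> D" "{..<r} \<times> {..<c} \<subseteq> E"
    and "\<And>a b. (a, b) \<in> D \<Longrightarrow> b < c \<Longrightarrow> a + c < N"
    and "\<And>a b. (a, b) \<in> D \<Longrightarrow> a < r \<Longrightarrow> b + r < N"
  shows "on_geodesic N D c (N - r)" "on_geodesic N E c (N - r)"
  using assms ED by (intro on_geodesicI D E; blast)+

text \<open>Beyond \<open>q\<close> there is a corner box \<open>(r, c)\<close> of \<open>E\<close>.
  The pair for the lattice point \<open>(Suc r, Suc c)\<close> is tight at \<open>D\<close> and
  \<open>E\<close>, and its two rectangles intersect in a set containing
  \<open>(r, c)\<close>.\<close>

lemma above_lower:
  assumes M: "M \<in> hook_ideals N"
    and geo: "\<And>i j. i \<le> N \<Longrightarrow> j \<le> N \<Longrightarrow> on_geodesic N D i j \<Longrightarrow> on_geodesic N E i j \<Longrightarrow> on_geodesic N M i j"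
  shows "E \<subseteq> M"
proof
  fix q assume "q \<in> E"
  let ?S = "{(a, b) \<in> E. fst q \<le> a \<and> snd q \<le> b}"
  have "?S \<subseteq> E" by auto
  then have "finite ?S" using hook_ideals_finite[OF E] by (rule finite_subset)
  have "q \<in> ?S" using \<open>q \<in> E\<close> by auto
  then have "?S \<noteq> {}" by blast
  from ex_is_arg_min_if_finite[OF \<open>finite ?S\<close> this, of "\<lambda>(a, b). - int (a + b)"]
  obtain r c where rc: "(r, c) \<in> E" "fst q \<le> r" "snd q \<le> c"
    and max: "\<And>a b. (a, b) \<in> E \<Longrightarrow> fst q \<le> a \<Longrightarrow> snd q \<le> b \<Longrightarrow> a + b \<le> r + c"
    by (force simp: is_arg_min_linorder)
  have out: "(Suc r, c) \<notin> E" "(r, Suc c) \<notin> E" using max rc by fastforce+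
  \<comment> \<open>Otherwise two different boxes would lie in \<open>D\<close> but not in
    \<open>E\<close>.\<close>
  have out': "(Suc r, Suc c) \<notin> D"
  proof
    assume "(Suc r, Suc c) \<in> D"
    then have "(Suc r, c) \<in> D" "(r, Suc c) \<in> D" using hook_ideals_down[OF D] by auto
    then have "(Suc r, c) = p" "(r, Suc c) = p" using out DE by blast+
    then show False by auto
  qed
  have rcD: "(r, c) \<in> D" using rc ED by blast
  have le: "Suc r + Suc c \<le> N" using hook_ideals_bound[OF D rcD rcD] by simp
  have sub: "{..<Suc r} \<times> {..<Suc c} \<subseteq> E" using hook_ideals_down[OF E rc(1)] by auto
  have "a + Suc c < N" if "(a, b) \<in> D" for a b
    using hook_ideals_bound[OF D that rcD] by simp
  moreover have "b + Suc r < N" if "(a, b) \<in> D" for a b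
    using hook_ideals_bound[OF D rcD that] by simp
  ultimately have "on_geodesic N D (Suc c) (N - Suc r)" "on_geodesic N E (Suc c) (N - Suc r)"
    by (intro both_on_geodesic[OF le out' sub]; blast)+
  then have "on_geodesic N M (Suc c) (N - Suc r)"
    using hook_ideals_bound[OF D rcD rcD] by (intro geo) auto
  then have "(r, c) \<in> M"
    using hook_ideals_bound[OF D rcD rcD] by (auto simp: on_geodesic_def in_rect)
  then show "q \<in> M" using hook_ideals_down[OF M] rc by (metis prod.collapse)
qed

text \<open>Dual to \<open>above_lower\<close>: before a box \<open>q\<close> outside
  \<open>D\<close> there is a minimal such box \<open>(r, c)\<close>, and the union of the two
  rectangles for this lattice point omits it.\<close>

lemma below_upper:
  assumes M: "M \<in> hook_ideals N"
    and geo: "\<And>i j. i \<le> N \<Longrightarrow> j \<le> N \<Longrightarrow> on_geodesic N D i j \<Longrightarrow> on_geodesic N E i j \<Longrightarrow> on_geodesic N M i j"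
  shows "M \<subseteq> D"
proof (rule subsetI, rule ccontr)
  fix q assume "q \<in> M" "q \<notin> D"
  let ?S = "{(a, b). (a, b) \<notin> D \<and> a \<le> fst q \<and> b \<le> snd q}"
  have "?S \<subseteq> {..fst q} \<times> {..snd q}" by auto
  then have "finite ?S" by (rule finite_subset) simp
  have "q \<in> ?S" using \<open>q \<notin> D\<close> by auto
  then have "?S \<noteq> {}" by blast
  from ex_is_arg_min_if_finite[OF \<open>finite ?S\<close> this, of "\<lambda>(a, b). a + b"]
  obtain r c where rc: "(r, c) \<notin> D" "r \<le> fst q" "c \<le> snd q"
    and min: "\<And>a b. (a, b) \<notin> D \<Longrightarrow> a \<le> fst q \<Longrightarrow> b \<le> snd q \<Longrightarrow> r + c \<le> a + b"
    by (force simp: is_arg_min_linorder)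
  have left: "(r, c - 1) \<in> D" if "0 < c" using min[of r "c - 1"] that rc by fastforce
  have up: "(r - 1, c) \<in> D" if "0 < r" using min[of "r - 1" c] that rc by fastforce
  have le: "r + c \<le> N"
    using hook_ideals_bound[OF D left left] hook_ideals_bound[OF D up up] by (cases "c = 0"; cases "r = 0") auto
  have sub: "{..<r} \<times> {..<c} \<subseteq> E"
  proof (cases "0 < r \<and> 0 < c")
    case True
    then show ?thesis using rect_below[OF left up, of r c] by auto
  qed auto
  have "a + c < N" if "(a, b) \<in> D" "b < c" for a b
    using hook_ideals_bound[OF D that(1) left] that by linarith
  moreover have "b + r < N" if "(a, b) \<in> D" "a < r" for a b
    using hook_ideals_bound[OF D up that(1)] that by linarith
  ultimately have "on_geodesic N M c (N - r)"
    using le by (intro geo both_on_geodesic[OF le rc(1) sub]) auto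
  then have "M \<subseteq> rect N c \<union> rect N (N - r)" by (simp add: on_geodesic_def)
  moreover have "(r, c) \<notin> rect N c \<union> rect N (N - r)" using le by (simp add: in_rect)
  ultimately have "(r, c) \<notin> M" by blast
  then show False using hook_ideals_down[OF M, of "fst q" "snd q" r c] \<open>q \<in> M\<close> rc by simp
qed

text \<open>Every rectangle needs a partner tight at both diagrams; this is what bounds the face.
  The partner is read off where the line of column \<open>i\<close>, or of row \<open>N - i\<close>,
  meets the boundary path.\<close>

lemma common_geodesic:
  assumes "i \<le> N"
  obtains j where "j \<le> N" "on_geodesic N D i j" "on_geodesic N E i j"
proof -
  \<comment> \<open>Ensures that the two \<open>LEAST\<close> below exist.\<close>
  have outside: "(N, c) \<notin> D" "(r, N) \<notin> D" for r c
    using hook_ideals_bound[OF D, of N c N c] hook_ideals_bound[OF D, of r N r N] by auto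
  show thesis
  proof (cases "i = 0 \<or> (0, i - 1) \<in> D")
    case True
    define r where "r = (LEAST r. (r, i) \<notin> D)"
    have r: "(r, i) \<notin> D" unfolding r_def using outside by (metis LeastI)
    have up: "(r - 1, i) \<in> D" if "0 < r"
      using not_less_Least[of "r - 1" "\<lambda>r. (r, i) \<notin> D"] that by (auto simp: r_def)
    have le: "r + i \<le> N"
      using hook_ideals_bound[OF D up up] assms by (cases "r = 0") auto
    have sub: "{..<r} \<times> {..<i} \<subseteq> E"
    proof (cases "0 < r \<and> 0 < i")
      case True
      then have "(r - 1, i - 1) \<in> D" using hook_ideals_down[OF D up] by auto
      moreover have "(r - 1, i) \<noteq> (r - 1, i - 1)" using True by (cases i) auto
      ultimately show ?thesis using rect_below[OF up, of "r - 1" "i - 1" r i] True by simp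
    qed auto
    have "a + i < N" if "(a, b) \<in> D" "b < i" for a b
      using hook_ideals_bound[OF D that(1), of 0 "i - 1"] True that by auto
    moreover have "b + r < N" if "(a, b) \<in> D" "a < r" for a b
      using hook_ideals_bound[OF D up that(1)] that by linarith
    ultimately have "on_geodesic N D i (N - r)" "on_geodesic N E i (N - r)"
      by (intro both_on_geodesic[OF le r sub]; blast)+
    then show thesis using that[of "N - r"] by auto
  next
    \<comment> \<open>Here \<open>D\<close> has fewer than \<open>i\<close> columns, so the row
      \<open>N - i\<close> is followed instead; \<open>i = N - r\<close> is then the second index of
      the pair.\<close>
    case False
    define r where "r = N - i"
    define c where "c = (LEAST c. (r, c) \<notin> D)"
    have c: "(r, c) \<notin> D" unfolding c_def using outside by (metis LeastI)
    have left: "(r, c - 1) \<in> D" if "0 < c"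
      using not_less_Least[of "c - 1" "\<lambda>c. (r, c) \<notin> D"] that by (auto simp: c_def)
    have narrow: "b < i - 1" if "(a, b) \<in> D" for a b
      using hook_ideals_down[OF D that, of 0 "i - 1"] False by force
    have le: "r + c \<le> N"
      using narrow[OF left] assms by (cases "c = 0") (auto simp: r_def)
    have sub: "{..<r} \<times> {..<c} \<subseteq> E"
    proof (cases "0 < r \<and> 0 < c")
      case True
      then have "(r - 1, c - 1) \<in> D" using hook_ideals_down[OF D left] by auto
      moreover have "(r, c - 1) \<noteq> (r - 1, c - 1)" using True by (cases r) auto
      ultimately show ?thesis using rect_below[OF left, of "r - 1" "c - 1" r c] True by simp
    qed auto
    have "a + c < N" if "(a, b) \<in> D" "b < c" for a b
      using hook_ideals_bound[OF D that(1) left] that by linarith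
    moreover have "b + r < N" if "(a, b) \<in> D" "a < r" for a b
      using narrow[OF that(1)] assms by (auto simp: r_def)
    ultimately have "on_geodesic N D c (N - r)" "on_geodesic N E c (N - r)"
      by (intro both_on_geodesic[OF le c sub]; blast)+
    moreover have "N - r = i" "c \<le> N" using assms le by (auto simp: r_def)
    ultimately show thesis using that[of c] by (simp add: on_geodesic_commute)
  qed
qed

end

text \<open>Two tight pairs never lie apart on the circle; hence the tight pairs form a chain in the
  product order, and the rectangles they span fit together to a single diagram.\<close>

lemma tight_pairs_hook_ideal:
  fixes k :: "'n \<Rightarrow> nat" and f :: "'n \<Rightarrow> real"
  assumes k: "\<And>x. k x < N" and f: "\<And>x y. rect_dist N (k x) (k y) \<le> f x + f y"
  shows "\<exists>D\<in>hook_ideals N. \<forall>x y. f x + f y = rect_dist N (k x) (k y)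
    \<longrightarrow> on_geodesic N D (k x) (k y)"
proof -
  define T where "T x y \<longleftrightarrow> f x + f y = rect_dist N (k x) (k y)" for x y
  have T_sym: "T y x" if "T x y" for x y using that by (simp add: T_def rect_dist_commute add.commute)
  \<comment> \<open>Exchanging partners in two separated, or strictly nested, tight pairs would
    increase the sum of distances strictly beyond the sum of the four values of
    \<open>f\<close>.\<close>
  have apart: "\<not> k y < k u" if "T x y" "T u v" "k x \<le> k y" "k u \<le> k v" for x y u v
    using rect_dist_apart[OF that(3) _ that(4) k] f[of x u] f[of y v] that(1,2)
    unfolding T_def by force
  have nested: "\<not> (k x < k u \<and> k v < k y)" if "T x y" "T u v" "k u \<le> k v" for x y u v
    using rect_dist_nested[of "k x" "k u" "k v" "k y" N] f[of x v] f[of u y] that k[of y]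
    unfolding T_def by force
  \<comment> \<open>For \<open>k x \<le> k y\<close> each rectangle here is
    \<open>rect N (k x) \<inter> rect N (k y)\<close>, so \<open>D\<close> collects exactly the
    boxes that the tight pairs force.\<close>
  define D where "D = (\<Union>(x, y)\<in>{(x, y). T x y \<and> k x \<le> k y}. {..<N - k y} \<times> {..<k x})"
  have in_D: "(a, b) \<in> D \<longleftrightarrow> (\<exists>x y. T x y \<and> k x \<le> k y \<and> a < N - k y \<and> b < k x)" for a b
    by (auto simp: D_def)
  have "(a', b') \<in> D" if "(a, b) \<in> D" "a' \<le> a" "b' \<le> b" for a b a' b'
    using that unfolding in_D by (meson le_less_trans)
  moreover have "a + b' + 2 \<le> N" if "(a, b) \<in> D" "(a', b') \<in> D" for a b a' b'
  proof -
    obtain x y where xy: "T x y" "k x \<le> k y" "a < N - k y" using \<open>(a, b) \<in> D\<close> in_D by blast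
    obtain u v where uv: "T u v" "k u \<le> k v" "b' < k u" using \<open>(a', b') \<in> D\<close> in_D by blast
    show ?thesis using apart[OF xy(1) uv(1) xy(2) uv(2)] xy(3) uv(3) by linarith
  qed
  ultimately have "D \<in> hook_ideals N" unfolding hook_ideals_def by blast
  moreover have geo: "on_geodesic N D (k u) (k v)" if uv: "T u v" "k u \<le> k v" for u v
    unfolding on_geodesic_def
  proof
    have "rect N (k u) \<inter> rect N (k v) \<subseteq> {..<N - k v} \<times> {..<k u}" by (auto simp: rect_def)
    then show "rect N (k u) \<inter> rect N (k v) \<subseteq> D" using uv unfolding D_def by blast
    show "D \<subseteq> rect N (k u) \<union> rect N (k v)"
    proof (rule subrelI)
      fix a b assume "(a, b) \<in> D"
      then obtain x y where xy: "T x y" "k x \<le> k y" "a < N - k y" "b < k x" using in_D by blast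
      \<comment> \<open>The pair \<open>x, y\<close> is not strictly inside \<open>u, v\<close>: if
        \<open>k x \<le> k u\<close> the box lies in the first rectangle, if
        \<open>k v \<le> k y\<close> in the second.\<close>
      show "(a, b) \<in> rect N (k u) \<union> rect N (k v)"
        using apart[OF xy(1) uv(1) xy(2) uv(2)] apart[OF uv(1) xy(1) uv(2) xy(2)]
          nested[OF uv(1) xy(1,2)] xy uv(2) by (auto simp: in_rect)
    qed
  qed
  moreover have "on_geodesic N D (k u) (k v)" if "T u v" for u v
    using geo[OF that] geo[OF T_sym[OF that]] by (meson nat_le_linear on_geodesic_commute)
  ultimately show ?thesis unfolding T_def by blast
qed

section \<open>Faces of the polyhedron\<close>

lemma hull_polyhedron_halfspaces:
  "hull_polyhedron d = (\<Inter>(x, y). {f. (axis x 1 + axis y 1) \<bullet> f \<ge> d x y})"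
  by (auto simp: hull_polyhedron_def inner_add_left inner_axis')

lemma convex_hull_polyhedron: "convex (hull_polyhedron d)"
  unfolding hull_polyhedron_halfspaces by (intro convex_INT) (auto simp: convex_halfspace_ge)

lemma closed_hull_polyhedron: "closed (hull_polyhedron d)"
  unfolding hull_polyhedron_halfspaces by (intro closed_INT) (auto simp: closed_halfspace_ge)

text \<open>The segment from \<open>g\<close> to \<open>c\<close> can be prolonged a little beyond
  \<open>c\<close>: constraints tight at \<open>c\<close> are tight along the whole line, the others
  have slack. So \<open>c\<close> is an inner point of a segment starting at
  \<open>g\<close>.\<close>

lemma in_face_if_tight:
  fixes d :: "'n::finite \<Rightarrow> 'n \<Rightarrow> real"
  assumes F: "F face_of hull_polyhedron d" "c \<in> F" and g: "g \<in> hull_polyhedron d"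
    and tight: "\<And>x y. c $ x + c $ y = d x y \<Longrightarrow> g $ x + g $ y = d x y"
  shows "g \<in> F"
proof (cases "g = c")
  case False
  have c: "c \<in> hull_polyhedron d" using F face_of_imp_subset by blast
  define S where "S = {(x, y). c $ x + c $ y \<noteq> d x y}"
  \<comment> \<open>There are finitely many slack constraints, so one small \<open>e\<close> serves
    them all.\<close>
  have "eventually (\<lambda>e. e * (g $ fst p + g $ snd p - d (fst p) (snd p))
      < c $ fst p + c $ snd p - d (fst p) (snd p)) (at_right 0)" if "p \<in> S" for p
  proof (rule order_tendstoD(2))
    show "((\<lambda>e. e * (g $ fst p + g $ snd p - d (fst p) (snd p))) \<longlongrightarrow>
        0 * (g $ fst p + g $ snd p - d (fst p) (snd p))) (at_right 0)"
      by (intro tendsto_intros)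
    have "d (fst p) (snd p) \<le> c $ fst p + c $ snd p" using c by (simp add: hull_polyhedron_def)
    then show "0 * (g $ fst p + g $ snd p - d (fst p) (snd p)) < c $ fst p + c $ snd p - d (fst p) (snd p)"
      using that by (auto simp: S_def)
  qed
  then have "eventually (\<lambda>e. \<forall>p\<in>S. e * (g $ fst p + g $ snd p - d (fst p) (snd p))
      < c $ fst p + c $ snd p - d (fst p) (snd p)) (at_right 0)"
    by (intro eventually_ball_finite) auto
  then have "eventually (\<lambda>e. 0 < e \<and> (\<forall>p\<in>S. e * (g $ fst p + g $ snd p - d (fst p) (snd p))
      < c $ fst p + c $ snd p - d (fst p) (snd p))) (at_right 0)"
    using eventually_conj[OF eventually_at_right_less] by blast
  then obtain e :: real where e: "0 < e" and slack: "\<And>x y. c $ x + c $ y \<noteq> d x y \<Longrightarrow>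
      e * (g $ x + g $ y - d x y) < c $ x + c $ y - d x y"
    by (auto simp: S_def dest!: eventually_happens'[OF trivial_limit_at_right_real])
  define h where "h = c + e *\<^sub>R (c - g)"
  have h: "h \<in> hull_polyhedron d"
  proof -
    have "d x y \<le> h $ x + h $ y" for x y
    proof (cases "c $ x + c $ y = d x y")
      case True
      have "h $ x + h $ y = (c $ x + c $ y) + e * ((c $ x + c $ y) - (g $ x + g $ y))"
        by (simp add: h_def algebra_simps)
      then show ?thesis using True tight[OF True] by simp
    next
      case False
      have "h $ x + h $ y - d x y
          = (c $ x + c $ y - d x y) - e * (g $ x + g $ y - d x y) + e * (c $ x + c $ y - d x y)"
        by (simp add: h_def algebra_simps)
      moreover have "0 \<le> e * (c $ x + c $ y - d x y)"
        using c e by (simp add: hull_polyhedron_def)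
      ultimately show ?thesis using slack[OF False] by linarith
    qed
    then show ?thesis by (simp add: hull_polyhedron_def)
  qed
  have "c \<in> open_segment g h"
  proof -
    have "(1 - u) *\<^sub>R g + u *\<^sub>R h = (1 - u * (1 + e)) *\<^sub>R g + (u * (1 + e)) *\<^sub>R c" for u
      by (simp add: h_def algebra_simps)
    from this[of "1 / (1 + e)"] have "c = (1 - 1 / (1 + e)) *\<^sub>R g + (1 / (1 + e)) *\<^sub>R h"
      using e by simp
    moreover have "g \<noteq> h"
    proof
      assume "g = h"
      then have "(1 + e) *\<^sub>R (g - c) = 0" by (simp add: h_def algebra_simps)
      then show False using False e by simp
    qed
    ultimately show ?thesis using e unfolding in_segment by (intro conjI exI[of _ "1 / (1 + e)"]) auto
  qed
  then show ?thesis using face_ofD[OF F(1) _ g h F(2)] by blast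
qed (use F in simp)

definition tight_face :: "('n::finite \<Rightarrow> 'n \<Rightarrow> real) \<Rightarrow> ('n \<Rightarrow> 'n \<Rightarrow> bool) \<Rightarrow> (real ^ 'n) set" where
  "tight_face d Q = {g \<in> hull_polyhedron d. \<forall>x y. Q x y \<longrightarrow> g $ x + g $ y = d x y}"

lemma tight_face_face_of: "tight_face d Q face_of hull_polyhedron d"
proof -
  let ?H = "\<lambda>(x, y). hull_polyhedron d \<inter> {g. (axis x 1 + axis y 1) \<bullet> g = d x y}"
  \<comment> \<open>Inserting the polyhedron keeps the family nonempty even if \<open>Q\<close>
    holds for no pair.\<close>
  have "\<Inter> (insert (hull_polyhedron d) (?H ` {(x, y). Q x y})) face_of hull_polyhedron d"
  proof (rule face_of_Inter)
    fix T assume "T \<in> insert (hull_polyhedron d) (?H ` {(x, y). Q x y})"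
    then consider "T = hull_polyhedron d" | x y where "T = ?H (x, y)" by blast
    then show "T face_of hull_polyhedron d"
    proof cases
      case 1
      then show ?thesis by (simp add: face_of_refl convex_hull_polyhedron)
    next
      case (2 x y)
      have "hull_polyhedron d \<inter> {g. (axis x 1 + axis y 1) \<bullet> g = d x y} face_of hull_polyhedron d"
        by (rule face_of_Int_supporting_hyperplane_ge[OF convex_hull_polyhedron])
          (simp add: hull_polyhedron_def inner_add_left inner_axis')
      then show ?thesis using 2 by simp
    qed
  qed simp
  moreover have "\<Inter> (insert (hull_polyhedron d) (?H ` {(x, y). Q x y})) = tight_face d Q"
    by (auto simp: tight_face_def inner_add_left inner_axis')
  ultimately show ?thesis by simp
qed

text \<open>The diagonal constraints make coordinates nonnegative, and a tight partner bounds each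
  of them above.\<close>

lemma bounded_tight_face:
  fixes d :: "'n::finite \<Rightarrow> 'n \<Rightarrow> real"
  assumes "\<And>x. 0 \<le> d x x" "\<And>x. \<exists>y. Q x y"
  shows "bounded (tight_face d Q)"
proof -
  obtain m where m: "\<And>x. Q x (m x)" using assms(2) by metis
  have "norm g \<le> (\<Sum>x\<in>UNIV. d x (m x))" if g: "g \<in> tight_face d Q" for g
  proof -
    have "0 \<le> g $ x" for x
    proof -
      have "d x x \<le> g $ x + g $ x" using g unfolding tight_face_def hull_polyhedron_def by blast
      then show ?thesis using assms(1)[of x] by linarith
    qed
    moreover have "g $ x + g $ m x = d x (m x)" for x using g m by (simp add: tight_face_def)
    ultimately have "\<bar>g $ x\<bar> \<le> d x (m x)" for x by (metis abs_of_nonneg le_add_same_cancel1)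
    then show ?thesis using norm_le_l1_cart[of g] by (meson order_trans sum_mono)
  qed
  then show ?thesis by (auto simp: bounded_iff)
qed

section \<open>The vertices and edges\<close>

locale boundary_labels =
  fixes N :: nat and k :: "'n::finite \<Rightarrow> nat"
  assumes range_k: "range k = {..<N}"
begin

definition d :: "'n \<Rightarrow> 'n \<Rightarrow> real" where
  "d x y = rect_dist N (k x) (k y)"

definition vertex :: "(nat \<times> nat) set \<Rightarrow> real ^ 'n" where
  "vertex D = (\<chi> x. real (card (sym_diff D (rect N (k x)))))"

lemma k_less: "k x < N"
  using range_k by blast

text \<open>Rectangles are equated, not indices, since index \<open>N\<close> is served by the label
  of 0.\<close>

lemma label_of:
  assumes "i \<le> N"
  obtains x where "rect N (k x) = rect N i"
proof (cases "i = N")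
  case True
  have "0 \<in> range k" using range_k k_less by fastforce
  then show ?thesis using that True rect_N by (metis rangeE)
next
  case False
  then have "i \<in> range k" using assms range_k by auto
  then show ?thesis using that by blast
qed

lemma vertex_tight:
  assumes "D \<in> hook_ideals N"
  shows "vertex D $ x + vertex D $ y = d x y \<longleftrightarrow> on_geodesic N D (k x) (k y)"
  using on_geodesic_iff[OF hook_ideals_finite[OF assms]] by (simp add: vertex_def d_def)

lemma vertex_in_polyhedron:
  assumes "D \<in> hook_ideals N"
  shows "vertex D \<in> hull_polyhedron d"
  using card_sym_diff_triangle[OF finite_rect finite_rect hook_ideals_finite[OF assms]]
  unfolding hull_polyhedron_def vertex_def d_def rect_dist_def
  by (auto simp flip: of_nat_add)

text \<open>The singleton of an extreme point is a face, so it contains every point that is tight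
  wherever the extreme point is.\<close>

lemma extreme_point_vertex:
  assumes "g extreme_point_of hull_polyhedron d"
  obtains D where "D \<in> hook_ideals N" "g = vertex D"
proof -
  have "g \<in> hull_polyhedron d" using assms by (simp add: extreme_point_of_def)
  then have "rect_dist N (k x) (k y) \<le> g $ x + g $ y" for x y
    by (simp add: hull_polyhedron_def d_def)
  from tight_pairs_hook_ideal[of k N "\<lambda>x. g $ x", OF k_less this]
  obtain D where D: "D \<in> hook_ideals N"
    "\<And>x y. g $ x + g $ y = rect_dist N (k x) (k y) \<Longrightarrow> on_geodesic N D (k x) (k y)"
    by blast
  have "vertex D \<in> {g}"
  proof (rule in_face_if_tight[of _ d g])
    show "{g} face_of hull_polyhedron d" using assms by (simp add: face_of_singleton)
    show "vertex D \<in> hull_polyhedron d" using D(1) by (rule vertex_in_polyhedron)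
    show "vertex D $ x + vertex D $ y = d x y" if "g $ x + g $ y = d x y" for x y
      using that D(2) vertex_tight[OF D(1)] by (simp add: d_def)
  qed simp
  then show ?thesis using that D by auto
qed

lemma near_cover_face:
  assumes "near_cover N D E p"
  shows "closed_segment (vertex D) (vertex E) \<in> hull_faces d"
proof -
  interpret near_cover N D E p by fact
  define F where "F = tight_face d (\<lambda>x y. on_geodesic N D (k x) (k y) \<and> on_geodesic N E (k x) (k y))"
  have F: "F face_of hull_polyhedron d" unfolding F_def by (rule tight_face_face_of)
  have "bounded F"
    unfolding F_def
  proof (rule bounded_tight_face)
    fix x
    show "0 \<le> d x x" by (simp add: d_def rect_dist_def)
    obtain j where "j \<le> N" "on_geodesic N D (k x) j" "on_geodesic N E (k x) j"
      using common_geodesic[of "k x"] k_less[of x] by auto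
    moreover obtain y where "rect N (k y) = rect N j" using label_of[OF \<open>j \<le> N\<close>] .
    ultimately show "\<exists>y. on_geodesic N D (k x) (k y) \<and> on_geodesic N E (k x) (k y)"
      unfolding on_geodesic_def by metis
  qed
  moreover have "closed F" using F face_of_imp_closed convex_hull_polyhedron closed_hull_polyhedron by blast
  ultimately have "compact F" using compact_eq_bounded_closed by blast
  moreover have "convex F" using F face_of_imp_convex by blast
  ultimately have KM: "F = convex hull {g. g extreme_point_of F}" by (rule Krein_Milman_Minkowski)
  have vF: "vertex D \<in> F" "vertex E \<in> F"
    using vertex_in_polyhedron D E vertex_tight by (auto simp: F_def tight_face_def)
  have "g = vertex D \<or> g = vertex E" if "g extreme_point_of F" for g
  proof -
    have "g extreme_point_of hull_polyhedron d" using that F extreme_point_of_face by blast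
    then obtain M where M: "M \<in> hook_ideals N" "g = vertex M" by (rule extreme_point_vertex)
    have "g \<in> F" using that by (simp add: extreme_point_of_def)
    then have "on_geodesic N M (k x) (k y)" if "on_geodesic N D (k x) (k y)" "on_geodesic N E (k x) (k y)" for x y
      using M vertex_tight that by (auto simp: F_def tight_face_def)
    \<comment> \<open>Passes from labels to all indices up to \<open>N\<close>, as the squeeze
      between \<open>E\<close> and \<open>D\<close> requires.\<close>
    then have "on_geodesic N M i j" if "i \<le> N" "j \<le> N" "on_geodesic N D i j" "on_geodesic N E i j" for i j
      using label_of[OF that(1)] label_of[OF that(2)] that(3,4) unfolding on_geodesic_def by metis
    then have "E \<subseteq> M" "M \<subseteq> D" using above_lower[OF M(1)] below_upper[OF M(1)] by blast+
    then have "M = D \<or> M = E" using DE by blast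
    then show ?thesis using M by auto
  qed
  then have "{g. g extreme_point_of F} \<subseteq> {vertex D, vertex E}" by auto
  then have "F \<subseteq> closed_segment (vertex D) (vertex E)"
    unfolding segment_convex_hull by (subst KM) (rule hull_mono)
  moreover have "closed_segment (vertex D) (vertex E) \<subseteq> F"
    using vF \<open>convex F\<close> by (rule closed_segment_subset)
  ultimately have "F = closed_segment (vertex D) (vertex E)" by blast
  then show ?thesis using F \<open>bounded F\<close> vF by (auto simp: hull_faces_def)
qed

text \<open>The degenerate case \<open>E = D\<close>, where the segment is a point.\<close>

lemma vertex_face:
  assumes "D \<in> hook_ideals N"
  shows "{vertex D} \<in> hull_faces d"
proof -
  have "near_cover N D D p" for p using assms by unfold_locales auto
  from near_cover_face[OF this] show ?thesis by simp
qed

text \<open>The tight pairs at \<open>D\<close> determine \<open>D\<close>: with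
  \<open>E = D\<close> the two squeezing lemmas leave no other diagram.\<close>

lemma vertex_inj: "inj_on vertex (hook_ideals N)"
proof (rule inj_onI)
  fix D M assume D: "D \<in> hook_ideals N" and M: "M \<in> hook_ideals N" and eq: "vertex D = vertex M"
  interpret near_cover N D D "(0, 0)" using D by unfold_locales auto
  have "on_geodesic N M (k x) (k y)" if "on_geodesic N D (k x) (k y)" for x y
    using vertex_tight[OF D] vertex_tight[OF M] eq that by simp
  then have "on_geodesic N M i j" if "i \<le> N" "j \<le> N" "on_geodesic N D i j" for i j
    using label_of[OF that(1)] label_of[OF that(2)] that(3) unfolding on_geodesic_def by metis
  then show "D = M" using above_lower[OF M] below_upper[OF M] by blast
qed

lemma vertex_extreme:
  assumes "D \<in> hook_ideals N"
  shows "vertex D extreme_point_of hull_polyhedron d"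
  using vertex_face[OF assms] by (simp add: hull_faces_def face_of_singleton)

section \<open>Identification of the 0-faces and 1-faces\<close>

lemma zero_faces: "{F \<in> hull_faces d. aff_dim F = 0} = (\<lambda>D. {vertex D}) ` hook_ideals N"
proof (intro equalityI subsetI)
  fix F assume "F \<in> {F \<in> hull_faces d. aff_dim F = 0}"
  then obtain g where g: "F = {g}" "g extreme_point_of hull_polyhedron d"
    by (auto simp: hull_faces_def aff_dim_eq_0 face_of_singleton)
  then show "F \<in> (\<lambda>D. {vertex D}) ` hook_ideals N" using extreme_point_vertex[OF g(2)] by blast
qed (auto intro: vertex_face)

lemma one_faces:
  "{F \<in> hull_faces d. aff_dim F = 1} = {closed_segment (vertex D) (vertex E) | D E.
     D \<in> hook_ideals N \<and> E \<in> hook_ideals N \<and> (\<exists>p\<in>D. E = D - {p})}"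
proof (intro equalityI subsetI)
  fix F assume "F \<in> {closed_segment (vertex D) (vertex E) | D E.
     D \<in> hook_ideals N \<and> E \<in> hook_ideals N \<and> (\<exists>p\<in>D. E = D - {p})}"
  then obtain D E p where *: "F = closed_segment (vertex D) (vertex E)"
    "D \<in> hook_ideals N" "E \<in> hook_ideals N" "p \<in> D" "E = D - {p}" by blast
  have "near_cover N D E p" using * by unfold_locales auto
  then have "F \<in> hull_faces d" using near_cover_face *(1) by blast
  moreover have "vertex D \<noteq> vertex E" using inj_onD[OF vertex_inj] * by blast
  then have "aff_dim F = 1"
    using *(1) by (simp add: segment_convex_hull aff_dim_convex_hull aff_dim_2)
  ultimately show "F \<in> {F \<in> hull_faces d. aff_dim F = 1}" by blast
next
  fix F assume "F \<in> {F \<in> hull_faces d. aff_dim F = 1}"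
  then have F: "F face_of hull_polyhedron d" "bounded F" "F \<noteq> {}" and dim: "aff_dim F = 1"
    by (auto simp: hull_faces_def)
  have "convex F" "closed F"
    using F(1) face_of_imp_convex face_of_imp_closed convex_hull_polyhedron closed_hull_polyhedron by blast+
  moreover have "collinear F" using dim by (simp add: collinear_aff_dim)
  ultimately obtain a b where ab: "F = closed_segment a b"
    using F(2,3) compact_convex_collinear_segment compact_eq_bounded_closed by metis
  have "a extreme_point_of hull_polyhedron d" "b extreme_point_of hull_polyhedron d"
    using extreme_point_of_face[OF F(1)] ab by (auto simp: extreme_point_of_segment)
  then obtain D E where D: "D \<in> hook_ideals N" "a = vertex D" and E: "E \<in> hook_ideals N" "b = vertex E"
    using extreme_point_vertex by metis
  have "a \<noteq> b" using dim ab by auto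
  then have "D \<noteq> E" using D E by blast
  have between: "M = D \<or> M = E" if M: "M \<in> hook_ideals N" "D \<inter> E \<subseteq> M" "M \<subseteq> D \<union> E" for M
  proof -
    have "vertex M \<in> F"
    proof (rule in_face_if_tight[OF F(1)])
      \<comment> \<open>A constraint tight at the midpoint is tight at both ends.\<close>
      show "midpoint a b \<in> F" by (simp add: ab)
      show "vertex M \<in> hull_polyhedron d" using M vertex_in_polyhedron by blast
      fix x y assume mid: "midpoint a b $ x + midpoint a b $ y = d x y"
      have "d x y \<le> a $ x + a $ y" "d x y \<le> b $ x + b $ y"
        using vertex_in_polyhedron D E by (auto simp: hull_polyhedron_def)
      moreover have "midpoint a b $ x + midpoint a b $ y = ((a $ x + a $ y) + (b $ x + b $ y)) / 2"
        by (simp add: midpoint_def field_simps)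
      ultimately have "a $ x + a $ y = d x y" "b $ x + b $ y = d x y" using mid by auto
      then have "on_geodesic N D (k x) (k y)" "on_geodesic N E (k x) (k y)"
        using vertex_tight D E by auto
      then have "on_geodesic N M (k x) (k y)" using on_geodesic_between M(2,3) by blast
      then show "vertex M $ x + vertex M $ y = d x y" using vertex_tight M(1) by blast
    qed
    then have "vertex M extreme_point_of F"
      using vertex_extreme[OF M(1)] extreme_point_of_face[OF F(1)] by blast
    then have "vertex M = a \<or> vertex M = b" unfolding ab by (simp add: extreme_point_of_segment)
    then show ?thesis using inj_onD[OF vertex_inj] M(1) D E by blast
  qed
  \<comment> \<open>Removing a suitable box of \<open>D - E\<close> from \<open>D\<close> yields a
    diagram in between, which can only be \<open>E\<close>.\<close>
  have cover: "\<exists>p\<in>D. E = D - {p}" if D: "D \<in> hook_ideals N" and E: "E \<in> hook_ideals N" and "\<not> D \<subseteq> E"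
    and between: "\<And>M. M \<in> hook_ideals N \<Longrightarrow> D \<inter> E \<subseteq> M \<Longrightarrow> M \<subseteq> D \<union> E \<Longrightarrow> M = D \<or> M = E" for D E
  proof -
    obtain p where p: "p \<in> D - E" "D - {p} \<in> hook_ideals N"
      using hook_ideals_remove[OF D E \<open>\<not> D \<subseteq> E\<close>] by blast
    then have "D - {p} = D \<or> D - {p} = E" by (intro between) auto
    then show ?thesis using p by blast
  qed
  have "(\<exists>p\<in>D. E = D - {p}) \<or> (\<exists>p\<in>E. D = E - {p})"
  proof (cases "D \<subseteq> E")
    case True
    then have "\<not> E \<subseteq> D" using \<open>D \<noteq> E\<close> by blast
    then show ?thesis using cover[OF E(1) D(1)] between by blast
  next
    case False
    then show ?thesis using cover[OF D(1) E(1)] between by blast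
  qed
  then show "F \<in> {closed_segment (vertex D) (vertex E) | D E.
     D \<in> hook_ideals N \<and> E \<in> hook_ideals N \<and> (\<exists>p\<in>D. E = D - {p})}"
    using D E ab closed_segment_commute by blast
qed

text \<open>An extreme point of the polyhedron lying in a face is extreme there, hence an endpoint
  of the segment.\<close>

lemma zero_faces_in_segment:
  assumes D: "D \<in> hook_ideals N" and E: "E \<in> hook_ideals N"
    and F: "closed_segment (vertex D) (vertex E) \<in> hull_faces d"
  shows "{v \<in> hull_faces d. aff_dim v = 0 \<and> v \<subseteq> closed_segment (vertex D) (vertex E)}
    = {{vertex D}, {vertex E}}"
proof -
  have face: "closed_segment (vertex D) (vertex E) face_of hull_polyhedron d"
    using F by (simp add: hull_faces_def)
  have "M = D \<or> M = E" if "M \<in> hook_ideals N" "vertex M \<in> closed_segment (vertex D) (vertex E)" for M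
  proof -
    have "vertex M extreme_point_of closed_segment (vertex D) (vertex E)"
      using vertex_extreme[OF that(1)] that(2) extreme_point_of_face[OF face] by blast
    then show ?thesis
      using inj_onD[OF vertex_inj] that(1) D E by (auto simp: extreme_point_of_segment)
  qed
  moreover have "{v \<in> hull_faces d. aff_dim v = 0 \<and> v \<subseteq> closed_segment (vertex D) (vertex E)}
     = {v \<in> (\<lambda>D. {vertex D}) ` hook_ideals N. v \<subseteq> closed_segment (vertex D) (vertex E)}"
    unfolding zero_faces[symmetric] by blast
  ultimately show ?thesis using D E by auto
qed

lemma graph_iso_hasse: "graph_iso (hull_skeleton_graph d) (hasse N)"
proof -
  define g where "g l = {vertex (young_diagram l)}" for l
  have "inj_on (\<lambda>D. {vertex D}) (hook_ideals N)" using vertex_inj by (auto simp: inj_on_def)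
  then have "bij_betw (\<lambda>D. {vertex D}) (hook_ideals N) (fst (hull_skeleton_graph d))"
    by (simp add: bij_betw_def hull_skeleton_graph_def zero_faces)
  from bij_betw_trans[OF bij_betw_young_diagram this]
  have g: "bij_betw g (hook_bounded N) (fst (hull_skeleton_graph d))"
    by (simp add: g_def[abs_def] comp_def)
  have "snd (hull_skeleton_graph d) = {{{vertex D}, {vertex E}} | D E.
     D \<in> hook_ideals N \<and> E \<in> hook_ideals N \<and> (\<exists>p\<in>D. E = D - {p})}" (is "_ = ?E")
  proof -
    have seg: "closed_segment (vertex D) (vertex E) \<in> hull_faces d"
      if "D \<in> hook_ideals N" "E \<in> hook_ideals N" "\<exists>p\<in>D. E = D - {p}" for D E
      using one_faces that by blast
    let ?cover = "\<lambda>D E. D \<in> hook_ideals N \<and> E \<in> hook_ideals N \<and> (\<exists>p\<in>D. E = D - {p})"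
    let ?ends = "\<lambda>F. {v \<in> hull_faces d. aff_dim v = 0 \<and> v \<subseteq> F}"
    have "snd (hull_skeleton_graph d)
        = (\<lambda>(D, E). ?ends (closed_segment (vertex D) (vertex E))) ` {(D, E). ?cover D E}"
      unfolding hull_skeleton_graph_def snd_conv one_faces by auto
    also have "\<dots> = (\<lambda>(D, E). {{vertex D}, {vertex E}}) ` {(D, E). ?cover D E}"
      using zero_faces_in_segment[OF _ _ seg] by (intro image_cong) auto
    finally show ?thesis by auto
  qed
  also have "\<dots> = (\<lambda>(D, E). {{vertex D}, {vertex E}}) `
      {(D, E). D \<in> hook_ideals N \<and> E \<in> hook_ideals N \<and> (\<exists>p\<in>D. E = D - {p})}"
    by auto
  also have "{(D, E). D \<in> hook_ideals N \<and> E \<in> hook_ideals N \<and> (\<exists>p\<in>D. E = D - {p})}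
      = (\<lambda>(l, m). (young_diagram l, young_diagram m)) `
        {(l, m). l \<in> hook_bounded N \<and> m \<in> hook_bounded N \<and> covers l m}"
    (is "?L = ?R")
  proof (intro equalityI subrelI)
    fix D E assume "(D, E) \<in> ?L"
    then have DE: "D \<in> hook_ideals N" "E \<in> hook_ideals N" "\<exists>p\<in>D. E = D - {p}" by auto
    obtain l m where "l \<in> hook_bounded N" "young_diagram l = D" "m \<in> hook_bounded N" "young_diagram m = E"
      using DE by (metis hook_ideals_young_diagram)
    then show "(D, E) \<in> ?R" using DE covers_iff[of l N m] by (auto simp: image_iff)
  next
    fix D E assume "(D, E) \<in> ?R"
    then show "(D, E) \<in> ?L" using covers_iff[of _ N] young_diagram_in_hook_ideals by auto
  qed
  also have "(\<lambda>(D, E). {{vertex D}, {vertex E}}) ` \<dots> = (\<lambda>e. g ` e) ` snd (hasse N)"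
  proof -
    have "snd (hasse N)
        = (\<lambda>(l, m). {l, m}) ` {(l, m). l \<in> hook_bounded N \<and> m \<in> hook_bounded N \<and> covers l m}"
      unfolding hasse_def snd_conv by auto
    then show ?thesis by (simp add: image_image case_prod_beta g_def)
  qed
  finally have edges: "snd (hull_skeleton_graph d) = (\<lambda>e. g ` e) ` snd (hasse N)" .
  \<comment> \<open>\<open>g\<close> leads from the Hasse graph to the skeleton, while the claim
    asks for the opposite direction.\<close>
  define f where "f = inv_into (hook_bounded N) g"
  have "f ` g ` e = e" if "e \<in> snd (hasse N)" for e
    unfolding f_def using that g
    by (intro inv_into_image_cancel) (auto simp: hasse_def bij_betw_def)
  then have "(\<lambda>e. f ` e) ` snd (hull_skeleton_graph d) = snd (hasse N)"
    unfolding edges by (simp add: image_image)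
  moreover have "bij_betw f (fst (hull_skeleton_graph d)) (fst (hasse N))"
    using bij_betw_inv_into[OF g] by (simp add: f_def hasse_def)
  ultimately show ?thesis unfolding graph_iso_def by blast
qed

end

theorem theorem1p3:
  fixes N :: nat and x :: "'n::finite \<Rightarrow> nat list"
  assumes "N \<ge> 2"
    and "bij_betw x UNIV (hasse_boundary N)"
  shows "graph_iso
           (hull_skeleton_graph (\<lambda>i j. real (graph_dist (hasse N) (x i) (x j))))
           (hasse N)"
proof -
  have range_x: "range x = rect_partition N ` {..<N}"
    using assms hasse_boundary_eq[of N] by (simp add: bij_betw_def)
  \<comment> \<open>All parts of the rectangle equal \<open>j\<close>, so the last entry recovers
    the index; the prefixed 0 supplies it for the empty partition.\<close>
  have last: "last (0 # rect_partition N j) = j" if "j < N" for j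
    using that by (simp add: rect_partition_def)
  define k where "k i = last (0 # x i)" for i
  have x: "x i = rect_partition N (k i)" for i
  proof -
    obtain j where "x i = rect_partition N j" "j < N" using range_x by blast
    then show ?thesis using last by (simp add: k_def)
  qed
  have "range k = (\<lambda>l. last (0 # l)) ` range x" by (auto simp: k_def)
  also have "\<dots> = (\<lambda>j. last (0 # rect_partition N j)) ` {..<N}"
    unfolding range_x by (rule image_image)
  also have "\<dots> = {..<N}" using last by simp
  finally have "range k = {..<N}" .
  then interpret boundary_labels N k by unfold_locales
  have "real (graph_dist (hasse N) (x i) (x j)) = d i j" for i j
    by (simp add: x graph_dist_hasse rect_partition_in_hook_bounded young_diagram_rect_partition
      d_def rect_dist_def)
  then show ?thesis using graph_iso_hasse by simp
qed

end
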